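(* Let $m\ge2$ and $f,g\in\mathrm{PA}(m)$. Then $$\Phi(f)<\Phi(g)\iff\lambda(\psi_f)<\lambda(\psi_g).$$
   Context: Let $I=[0,1]$. A critical point of a continuous map $f:I\to I$ is a point having no neighborhood on which $f$ is injective. For $\lambda>1$, a $\lambda$-zig-zag map is a continuous piecewise-linear $f:I\to I$ all of whose linear branches have slope $\pm\lambda$ and whose critical points are precisely $k_i=i\lambda^{-1}$, $i=1,\dots,\lfloor\lambda\rfloor$; write $\lambda(f)=\lambda$. The postcritical set is $\mathrm{PC}(f)=\{f^n(k): n\ge 1,\ k \text{ critical}\}$, and $f$ is postcritically finite (PCF) if $\mathrm{PC}(f)$ is finite. Thickening, $\psi_f$, and $\mathrm{PA}(m)$. Let $f$ be a PCF zig-zag map with $p=|\mathrm{PC}(f)|$. Decorate $I$ with a loop (an "infinitesimal edge") at each point of $\mathrm{PC}(f)$ to get a graph $\tau$ smoothly embedded in $S^2$, each loop bounding a disc with exactly one puncture, and with one further puncture $\infty$ in the remaining complementary component. The map $f$ is of pseudo-Anosov type if (for a suitable choice of the side of $I$ on which each loop lies) there is an orientation-preserving pseudo-Anosov homeomorphism $\psi_f:S_{0,p+1}\to S_{0,p+1}$ of the $(p+1)$-punctured sphere for which $\tau$ is an invariant train track, whose train track map permutes the loops and becomes $f$ after the loops are collapsed. For zig-zag maps there is essentially only one such thickening. For $m\ge2$, $\mathrm{PA}(m)$ is the set of zig-zag maps of pseudo-Anosov type with exactly $m$ critical points and $|\mathrm{PC}(f)|\ge4$. Here $\lambda(\psi_f)$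 denotes the stretch factor of $\psi_f$; it is known that $\lambda(\psi_f)=\lambda(f)$, the absolute value of the slope of $f$. The map $\Phi$. If $f\in \mathrm{PA}(m)$ then $x=1$ is periodic; list its orbit increasingly as $x_1<\dots<x_N=1$ (for $m$ odd use labels $x_0<\dots<x_{N-1}=1$). The permutation type $\rho(f)$ is the permutation with $f(x_i)=x_{\rho(f)(i)}$. For $n\ge3$, $2\le k\le n-1$ let $\rho_e(n,k)\in\mathfrak S_n$ be: $1\mapsto n$; $i\mapsto i+(n-k)$ for $2\le i\le k-1$; $i\mapsto i-(k-1)$ for $k\le i\le n$. (For $k=2$ this is $i\mapsto i-1 \bmod n$.) Let $\rho_o(n,k)$ be the permutation of $\{0,1,\dots,n\}$: $0\mapsto n$, $1\mapsto 0$, $i\mapsto i+(n-k)$ for $2\le i\le k-1$, $i\mapsto i-(k-1)$ for $k\le i\le n$. Let $\kappa(n,k)=(1,2,\dots,k-1)\in\mathfrak S_n$ (a cycle fixing $k,\dots,n$) and $\rho_2(n,k)=\kappa(n,k)^{-1}\circ\rho_e(n,k)\circ\kappa(n,k)$. Put $\rho_m(n,k)=\rho_e(n,k)$ if $m\ge4$ is even, $\rho_o(n,k)$ if $m\ge 3$ is odd, $\rho_2(n,k)$ if $m=2$. It is known from earlier work that every $f\in\mathrm{PA}(m)$ has $\rho(f)=\rho_m(n,k)$ for some $n,k$ with $\gcd(n-k,n-1)=1$, and that each such $\rho_m(n,k)$ is the permutation type of exactly one $f\in\mathrm{PA}(m)$. Define $\Phi(f)=\frac{n-k}{n-1}$ if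 $\rho(f)=\rho_m(n,k)$; $\Phi:\mathrm{PA}(m)\to\mathbb Q\cap(0,1)$ is a bijection. Known explicit description of $\mathrm{PA}(m)$ (earlier work). Set $I_0=[0,k_1)$, $I_j=(k_j,k_{j+1})$ for $1\le j\le m-1$, $I_m=(k_m,1]$; the address of $x$ is $j$ if $x\in I_j$ and $k_j$ if $x=k_j$. The map $f\in\mathrm{PA}(m)$ with $\Phi(f)=\frac ab$ (lowest terms) is the unique zig-zag map with $m$ critical points, with $f(0)=0$ if $m$ is even and $f(0)=1$ if $m$ is odd, such that $x=1$ is periodic of minimal period $b+1$ ($m$ even) or $b+2$ ($m$ odd) and the addresses $\nu_i$ of $f^i(1)$ over one period are: for $0\le i\le b-2$, $\nu_i=m$ if $\frac ab t\in\{0,1,2,\dots\}$ for some $t\in[i,i+1]$ and $\nu_i=m-2$ otherwise; $\nu_{b-1}=m-1$; $\nu_b=k_1$; and, if $m$ is odd, $\nu_{b+1}=0$. *)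

theory Defs
  imports "HOL-Analysis.Analysis"
begin

section \<open>Zig-zag maps\<close>

text \<open>Maps of the unit interval are functions \<^typ>\<open>real \<Rightarrow> real\<close> whose values
  outside of \<open>{0..1}\<close> are irrelevant. Neighbourhoods are taken relative to \<open>{0..1}\<close>.\<close>

definition critical_points :: "(real \<Rightarrow> real) \<Rightarrow> real set" where
  "critical_points f = {x \<in> {0..1}. \<not> (\<exists>e>0. inj_on f ({0..1} \<inter> ball x e))}"

definition zigzag :: "real \<Rightarrow> (real \<Rightarrow> real) \<Rightarrow> bool" where
  "zigzag lam f \<longleftrightarrow>
     lam > 1 \<and> continuous_on {0..1} f \<and> f ` {0..1} \<subseteq> {0..1} \<and>
     (\<exists>B. finite B \<and>
        (\<forall>a b. 0 \<le> a \<and> a < b \<and> b \<le> 1 \<and> {a<..<b} \<inter> B = {} \<longrightarrow>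
           (\<exists>s\<in>{lam, -lam}. \<exists>c. \<forall>x\<in>{a..b}. f x = s * x + c))) \<and>
     critical_points f = (\<lambda>i. real i / lam) ` {1..nat \<lfloor>lam\<rfloor>}"

definition PC :: "(real \<Rightarrow> real) \<Rightarrow> real set" where
  "PC f = {(f ^^ n) k | n k. n \<ge> 1 \<and> k \<in> critical_points f}"


section \<open>Pseudo-Anosov homeomorphisms of punctured spheres\<close>

text \<open>The sphere is the plane together with \<open>\<infinity>\<close>, and \<open>\<infinity>\<close> is always a puncture: for a finite
  set \<open>P\<close> with \<open>p\<close> elements, \<open>- P\<close> is the sphere with \<open>p + 1\<close> punctures.

  A transverse pair of singular measured foliations is given by an atlas \<open>A\<close> of pairs \<open>(U, h)\<close> on
  the complement of the finite singular set, with changes of charts \<open>w \<mapsto> \<plusminus>w + c\<close>. The measures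
  are \<open>|d (Im h)|\<close> (unstable foliation, with horizontal leaves) and \<open>|d (Re h)|\<close> (stable
  foliation, with vertical leaves).\<close>

type_synonym atlas = "(complex set \<times> (complex \<Rightarrow> complex)) set"

definition flat_atlas :: "complex set \<Rightarrow> atlas \<Rightarrow> bool" where
  "flat_atlas R A \<longleftrightarrow>
     (\<Union>(U, h)\<in>A. U) = R \<and>
     (\<forall>(U, h)\<in>A. open U \<and> continuous_on U h \<and> inj_on h U) \<and>
     (\<forall>(U, h)\<in>A. \<forall>(V, k)\<in>A. \<forall>z\<in>U \<inter> V.
        \<exists>e\<in>{1, -1}. \<exists>c. \<forall>\<^sub>F w in nhds z. k w = e * h w + c)"

text \<open>A \<open>k\<close>-pronged singularity at the point to which the filter \<open>F\<close> converges (\<open>at s\<close> for a point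
  of the plane, \<open>at_infinity\<close> for \<open>\<infinity>\<close>): on a deleted neighbourhood \<open>N\<close> there is a topological
  coordinate \<open>\<phi>\<close>, centred at the singularity, whose power \<open>\<phi> powr (k / 2)\<close> is a flat coordinate.
  The equation is squared because of the choice of a branch.\<close>

definition pronged :: "atlas \<Rightarrow> complex filter \<Rightarrow> nat \<Rightarrow> bool" where
  "pronged A F k \<longleftrightarrow>
     (\<exists>N \<phi> r. open N \<and> (\<forall>\<^sub>F z in F. z \<in> N) \<and> r > 0 \<and>
        continuous_on N \<phi> \<and> inj_on \<phi> N \<and> \<phi> ` N = ball 0 r - {0} \<and> (\<phi> \<longlongrightarrow> 0) F \<and>
        (\<forall>z\<in>N. \<exists>(U, h)\<in>A. z \<in> U \<and> (\<exists>c. \<forall>\<^sub>F w in nhds z. (h w - c)\<^sup>2 = \<phi> w ^ k)))"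

definition singular_flat_structure :: "complex set \<Rightarrow> complex set \<Rightarrow> atlas \<Rightarrow> bool" where
  "singular_flat_structure P Sing A \<longleftrightarrow>
     finite Sing \<and> Sing \<inter> P = {} \<and> flat_atlas (- P - Sing) A \<and>
     (\<forall>s\<in>Sing. \<exists>k\<ge>3. pronged A (at s) k) \<and>
     (\<forall>s\<in>P. \<exists>k\<ge>1. pronged A (at s) k) \<and>
     (\<exists>k\<ge>1. pronged A at_infinity k)"

text \<open>Orientation-preserving pseudo-Anosov homeomorphism with stretch factor \<open>lam\<close>: in flat charts
  it is \<open>(x, y) \<mapsto> \<plusminus>(lam x, y / lam) + c\<close>. Since the changes of charts have determinant \<open>1\<close>, the
  common sign in both coordinates expresses that orientation is preserved.\<close>

definition pseudo_anosov :: "complex set \<Rightarrow> real \<Rightarrow> (complex \<Rightarrow> complex) \<Rightarrow> bool" where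
  "pseudo_anosov P lam psi \<longleftrightarrow>
     finite P \<and> lam > 1 \<and> (\<exists>psi'. homeomorphism (- P) (- P) psi psi') \<and>
     (\<exists>Sing A. singular_flat_structure P Sing A \<and> psi ` Sing = Sing \<and>
        (\<forall>(U, h)\<in>A. \<forall>(V, k)\<in>A. \<forall>z\<in>U. psi z \<in> V \<longrightarrow>
           (\<exists>e\<in>{1, -1}. \<exists>c. \<forall>\<^sub>F w in nhds z.
              k (psi w) = e * Complex (lam * Re (h w)) (Im (h w) / lam) + c)))"

definition stretch_factor :: "complex set \<Rightarrow> (complex \<Rightarrow> complex) \<Rightarrow> real" where
  "stretch_factor P psi = (THE lam. pseudo_anosov P lam psi)"


section \<open>Thickenings\<close>

definition regular_path :: "(real \<Rightarrow> complex) \<Rightarrow> bool" where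
  "regular_path \<gamma> \<longleftrightarrow>
     (\<exists>D. continuous_on {0..1} D \<and>
        (\<forall>t\<in>{0..1}. D t \<noteq> 0 \<and> (\<gamma> has_vector_derivative D t) (at t within {0..1})))"

abbreviation unit_segment :: "complex set" where
  "unit_segment \<equiv> complex_of_real ` {0..1}"

text \<open>The interval decorated with a loop \<open>L x\<close> at each point \<open>x \<in> X\<close>.\<close>

definition decorated :: "real set \<Rightarrow> (real \<Rightarrow> real \<Rightarrow> complex) \<Rightarrow> complex set" where
  "decorated X L = unit_segment \<union> (\<Union>x\<in>X. path_image (L x))"

text \<open>The decorated interval is a train track. Both ends of a loop are tangent to the interval and
  point in the same direction \<open>d\<close> (so that a loop bounds a once-punctured monogon, as required of
  a train track), and there is a smooth path through every point. On which side of the interval a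
  loop lies is not prescribed.\<close>

definition loop_decoration ::
    "real set \<Rightarrow> (real \<Rightarrow> real \<Rightarrow> complex) \<Rightarrow> complex set \<Rightarrow> bool" where
  "loop_decoration X L P \<longleftrightarrow>
     (\<forall>x\<in>X. regular_path (L x) \<and> simple_path (L x) \<and>
        pathstart (L x) = of_real x \<and> pathfinish (L x) = of_real x \<and>
        path_image (L x) \<inter> unit_segment = {of_real x} \<and>
        (\<exists>d\<in>{1, -1}. \<exists>u>0. \<exists>v>0.
           (L x has_vector_derivative of_real (d * u)) (at 0 within {0..1}) \<and>
           (L x has_vector_derivative - of_real (d * v)) (at 1 within {0..1})) \<and>
        inside (path_image (L x)) \<inter> decorated X L = {} \<and>
        card (inside (path_image (L x)) \<inter> P) = 1) \<and>
     (\<forall>x\<in>X. \<forall>y\<in>X. x \<noteq> y \<longrightarrow> path_image (L x) \<inter> path_image (L y) = {}) \<and>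
     P \<subseteq> (\<Union>x\<in>X. inside (path_image (L x))) \<and>
     (\<forall>z\<in>decorated X L. \<exists>\<gamma>. regular_path \<gamma> \<and> path_image \<gamma> \<subseteq> decorated X L \<and> \<gamma> (1/2) = z)"

definition collapse :: "real set \<Rightarrow> (real \<Rightarrow> real \<Rightarrow> complex) \<Rightarrow> complex \<Rightarrow> real" where
  "collapse X L z =
     (if z \<in> unit_segment then Re z else (THE x. x \<in> X \<and> z \<in> path_image (L x)))"

text \<open>\<open>\<tau>\<close> is an invariant train track of \<open>psi\<close> with train track map \<open>g\<close>: up to homotopy in the
  punctured sphere, \<open>psi\<close> carries \<open>\<tau>\<close> into itself, taking smooth paths to smooth paths.\<close>

definition train_track_map ::
    "complex set \<Rightarrow> complex set \<Rightarrow> (complex \<Rightarrow> complex) \<Rightarrow> (complex \<Rightarrow> complex) \<Rightarrow> bool" where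
  "train_track_map P \<tau> psi g \<longleftrightarrow>
     continuous_on \<tau> g \<and> g ` \<tau> \<subseteq> \<tau> \<and>
     homotopic_with_canon (\<lambda>_. True) \<tau> (- P) psi g \<and>
     (\<forall>\<gamma>. regular_path \<gamma> \<and> path_image \<gamma> \<subseteq> \<tau> \<longrightarrow> regular_path (g \<circ> \<gamma>))"

text \<open>\<open>psi\<close> is the homeomorphism \<open>\<psi>\<^sub>f\<close> of the sphere punctured at \<open>P\<close> and \<open>\<infinity>\<close>. The image of a
  smooth path turning at a critical point has to run around the loop at the critical value;
  collapsing the loops therefore gives \<open>f\<close> only after collapsing some subintervals to points,
  which is what the monotone map \<open>c\<close> does.\<close>

definition thickening :: "(real \<Rightarrow> real) \<Rightarrow> complex set \<Rightarrow> (complex \<Rightarrow> complex) \<Rightarrow> bool" where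
  "thickening f P psi \<longleftrightarrow>
     (\<exists>lam. pseudo_anosov P lam psi) \<and>
     (\<exists>L g c. loop_decoration (PC f) L P \<and>
        train_track_map P (decorated (PC f) L) psi g \<and>
        bij_betw f (PC f) (PC f) \<and>
        (\<forall>x\<in>PC f. g (of_real x) = of_real (f x) \<and>
           bij_betw g (path_image (L x)) (path_image (L (f x)))) \<and>
        continuous_on {0..1} c \<and> mono_on {0..1} c \<and> c ` {0..1} = {0..1} \<and>
        (\<forall>x\<in>PC f. c x = x) \<and>
        (\<forall>t\<in>{0..1}. collapse (PC f) L (g (of_real t)) = f (c t)))"

definition PA :: "nat \<Rightarrow> (real \<Rightarrow> real) set" where
  "PA m = {f. (\<exists>lam. zigzag lam f) \<and> card (critical_points f) = m \<and>
              finite (PC f) \<and> card (PC f) \<ge> 4 \<and> (\<exists>P psi. thickening f P psi)}"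


section \<open>Permutation types and the map \<open>\<Phi>\<close>\<close>

text \<open>The orbit of \<open>1\<close>, listed increasingly with labels in \<open>S\<close>, is permuted by \<open>f\<close> according
  to \<open>r\<close>.\<close>

definition permutation_type :: "nat set \<Rightarrow> (real \<Rightarrow> real) \<Rightarrow> (nat \<Rightarrow> nat) \<Rightarrow> bool" where
  "permutation_type S f r \<longleftrightarrow>
     r permutes S \<and>
     (\<exists>x. strict_mono_on S x \<and> x ` S = range (\<lambda>i. (f ^^ i) 1) \<and> (\<forall>i\<in>S. f (x i) = x (r i)))"

definition rho_e :: "nat \<Rightarrow> nat \<Rightarrow> nat \<Rightarrow> nat" where
  "rho_e n k i =
     (if i = 1 then n
      else if 2 \<le> i \<and> i \<le> k - 1 then i + (n - k)
      else if k \<le> i \<and> i \<le> n then i - (k - 1)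
      else i)"

definition rho_o :: "nat \<Rightarrow> nat \<Rightarrow> nat \<Rightarrow> nat" where
  "rho_o n k i =
     (if i = 0 then n
      else if i = 1 then 0
      else if 2 \<le> i \<and> i \<le> k - 1 then i + (n - k)
      else if k \<le> i \<and> i \<le> n then i - (k - 1)
      else i)"

definition kappa :: "nat \<Rightarrow> nat \<Rightarrow> nat" where
  "kappa k i = (if 1 \<le> i \<and> i < k - 1 then i + 1 else if i = k - 1 then 1 else i)"

definition rho_2 :: "nat \<Rightarrow> nat \<Rightarrow> nat \<Rightarrow> nat" where
  "rho_2 n k = inv (kappa k) \<circ> rho_e n k \<circ> kappa k"

definition rho :: "nat \<Rightarrow> nat \<Rightarrow> nat \<Rightarrow> nat \<Rightarrow> nat" where
  "rho m n k = (if m = 2 then rho_2 n k else if even m then rho_e n k else rho_o n k)"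

definition labels :: "nat \<Rightarrow> nat \<Rightarrow> nat set" where
  "labels m n = (if even m then {1..n} else {0..n})"

definition Phi :: "nat \<Rightarrow> (real \<Rightarrow> real) \<Rightarrow> real" where
  "Phi m f =
     (THE q. \<exists>n k. 3 \<le> n \<and> 2 \<le> k \<and> k \<le> n - 1 \<and> coprime (n - k) (n - 1) \<and>
        permutation_type (labels m n) f (rho m n k) \<and> q = real (n - k) / real (n - 1))"


section \<open>The explicit description of the maps in \<open>PA m\<close>\<close>

definition branch :: "real \<Rightarrow> nat \<Rightarrow> nat \<Rightarrow> real set" where
  "branch lam m j =
     (if j = 0 then {0..<1 / lam}
      else if j = m then {real m / lam<..1}
      else {real j / lam<..<real (j + 1) / lam})"

text \<open>\<open>f\<close> is the zig-zag map with \<open>m\<close> critical points attached to \<open>a / b\<close>.\<close>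

definition explicit_map :: "nat \<Rightarrow> nat \<Rightarrow> nat \<Rightarrow> (real \<Rightarrow> real) \<Rightarrow> bool" where
  "explicit_map m a b f \<longleftrightarrow>
     (\<exists>lam. zigzag lam f \<and> card (critical_points f) = m \<and>
        f 0 = (if even m then 0 else 1) \<and>
        (let N = (if even m then b + 1 else b + 2) in
           (f ^^ N) 1 = 1 \<and> (\<forall>i. 0 < i \<and> i < N \<longrightarrow> (f ^^ i) 1 \<noteq> 1)) \<and>
        (\<forall>i. i + 2 \<le> b \<longrightarrow>
           (f ^^ i) 1 \<in> branch lam m
             (if \<exists>t. real i \<le> t \<and> t \<le> real (i + 1) \<and> real a / real b * t \<in> \<nat>
              then m else m - 2)) \<and>
        (f ^^ (b - 1)) 1 \<in> branch lam m (m - 1) \<and>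
        (f ^^ b) 1 = 1 / lam \<and>
        (odd m \<longrightarrow> (f ^^ (b + 1)) 1 \<in> branch lam m 0))"

end

(* Let lam be the slope of the map attached to a / b and x i the orbit of 1. Up to time b - 1 the
   orbit obeys x (i + 1) = lam * x i - address i, and address i tells whether a * (i + 1) / b is
   above, equal to or below the number of earlier addresses m. This number is c i, the value of
   a * i / b rounded up. Two consequences: the points x 0, ..., x (b - 1) are ordered like the
   residues of a * i - 1 modulo b, which gives the permutation type and Phi = a / b; and, for two
   parameters q < q', the first two different addresses are in the same order as q and q'. If
   lam >= lam', then x i >= x' i as long as the addresses agree, so that the first different
   addresses could not be in this order. If q = q', all addresses agree, and
   x (b - 1) = m / lam - 1 / lam^2 decreases with lam, so that lam = lam'. *)

theory Submission
  imports Defs "HOL-Combinatorics.Permutations"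
begin

section \<open>Zig-zag maps in closed form\<close>

text \<open>Induction on the number of points of \<open>B\<close> inside the interval. At such a
  point \<open>\<beta>\<close> two affine halves meet; opposite slopes would give equal values at
  \<open>\<beta> - \<delta>\<close> and \<open>\<beta> + \<delta>\<close> for small
  \<open>\<delta>\<close>, making \<open>\<beta>\<close> critical.\<close>

lemma affine_if_no_critical_point:
  fixes f :: "real \<Rightarrow> real"
  assumes "finite B"
    and aff: "\<forall>a b. 0 \<le> a \<and> a < b \<and> b \<le> 1 \<and> {a<..<b} \<inter> B = {} \<longrightarrow>
           (\<exists>s\<in>{lam, -lam}. \<exists>c. \<forall>x\<in>{a..b}. f x = s * x + c)"
    and "0 \<le> p" "p < q" "q \<le> 1" "{p<..<q} \<inter> critical_points f = {}"
  shows "\<exists>s\<in>{lam, -lam}. \<exists>c. \<forall>x\<in>{p..q}. f x = s * x + c"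
  using assms(3-6)
proof (induction "card ({p<..<q} \<inter> B)" arbitrary: p q rule: less_induct)
  case less
  show ?case
  proof (cases "{p<..<q} \<inter> B = {}")
    case True
    then show ?thesis using aff less.prems by blast
  next
    case False
    then obtain \<beta> where \<beta>: "p < \<beta>" "\<beta> < q" "\<beta> \<in> B" by auto
    have "card ({p<..<\<beta>} \<inter> B) < card ({p<..<q} \<inter> B)"
      using \<beta> \<open>finite B\<close> by (intro psubset_card_mono) auto
    then have "\<exists>s\<in>{lam, -lam}. \<exists>c. \<forall>x\<in>{p..\<beta>}. f x = s * x + c"
      by (rule less.hyps) (use less.prems \<beta> in \<open>auto simp: disjoint_iff\<close>)
    then obtain s c where s: "s \<in> {lam, -lam}" "\<forall>x\<in>{p..\<beta>}. f x = s * x + c" by blast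
    have "card ({\<beta><..<q} \<inter> B) < card ({p<..<q} \<inter> B)"
      using \<beta> \<open>finite B\<close> by (intro psubset_card_mono) auto
    then have "\<exists>s\<in>{lam, -lam}. \<exists>c. \<forall>x\<in>{\<beta>..q}. f x = s * x + c"
      by (rule less.hyps) (use less.prems \<beta> in \<open>auto simp: disjoint_iff\<close>)
    then obtain t d where t: "t \<in> {lam, -lam}" "\<forall>x\<in>{\<beta>..q}. f x = t * x + d" by blast
    have eq: "s * \<beta> + c = t * \<beta> + d"
      using s(2) t(2) \<beta> by (metis atLeastAtMost_iff less_eq_real_def)
    have "s = t"
    proof (rule ccontr)
      assume "s \<noteq> t"
      with s(1) t(1) have st: "t = - s" by auto
      have "\<beta> \<notin> critical_points f" using less.prems \<beta> by auto
      then obtain e where e: "e > 0" "inj_on f ({0..1} \<inter> ball \<beta> e)"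
        using less.prems \<beta> unfolding critical_points_def by auto
      define \<delta> where "\<delta> = min (e / 2) (min (\<beta> - p) (q - \<beta>))"
      have \<delta>: "0 < \<delta>" "\<delta> < e" "\<delta> \<le> \<beta> - p" "\<delta> \<le> q - \<beta>"
        using e \<beta> unfolding \<delta>_def by auto
      have "f (\<beta> - \<delta>) = s * (\<beta> - \<delta>) + c" "f (\<beta> + \<delta>) = t * (\<beta> + \<delta>) + d"
        using s(2) t(2) \<delta> by simp_all
      then have "f (\<beta> - \<delta>) = f (\<beta> + \<delta>)"
        using eq by (simp add: st algebra_simps)
      moreover have "\<beta> - \<delta> \<in> {0..1} \<inter> ball \<beta> e" "\<beta> + \<delta> \<in> {0..1} \<inter> ball \<beta> e"
        using \<delta> less.prems by (auto simp: dist_real_def)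
      ultimately have "\<beta> - \<delta> = \<beta> + \<delta>" using inj_onD[OF e(2)] by blast
      with \<delta> show False by simp
    qed
    with eq have "\<forall>x\<in>{p..q}. f x = s * x + c" using s(2) t(2) by force
    with s(1) show ?thesis by blast
  qed
qed

text \<open>On each piece the slope is forced by the left end value, which is \<open>0\<close> or \<open>1\<close>, because the
  values stay in \<open>{0..1}\<close>.\<close>

lemma zigzag_eq:
  fixes m j :: nat
  assumes zz: "zigzag lam f" and card: "card (critical_points f) = m"
    and f0: "f 0 = (if even m then 0 else 1)"
    and "j \<le> m" "real j / lam \<le> x" "x \<le> real (j + 1) / lam" "x \<le> 1"
  shows "f x = (if even (j + m) then lam * x - j else real (j + 1) - lam * x)"
proof -
  have lam: "lam > 1" and range: "f ` {0..1} \<subseteq> {0..1}"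
    and crit: "critical_points f = (\<lambda>i. real i / lam) ` {1..nat \<lfloor>lam\<rfloor>}"
    and "\<exists>B. finite B \<and>
        (\<forall>a b. 0 \<le> a \<and> a < b \<and> b \<le> 1 \<and> {a<..<b} \<inter> B = {} \<longrightarrow>
           (\<exists>s\<in>{lam, -lam}. \<exists>c. \<forall>x\<in>{a..b}. f x = s * x + c))"
    using zz unfolding zigzag_def by blast+
  then obtain B where "finite B"
    and aff: "\<forall>a b. 0 \<le> a \<and> a < b \<and> b \<le> 1 \<and> {a<..<b} \<inter> B = {} \<longrightarrow>
           (\<exists>s\<in>{lam, -lam}. \<exists>c. \<forall>x\<in>{a..b}. f x = s * x + c)"
    by (elim exE conjE)
  have "inj_on (\<lambda>i. real i / lam) {1..nat \<lfloor>lam\<rfloor>}" using lam by (auto simp: inj_on_def)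
  then have m: "m = nat \<lfloor>lam\<rfloor>" using card crit by (simp add: card_image)
  \<comment> \<open>The left end value is a premise because \<open>left\<close> obtains it by
    induction, evaluating the preceding piece at its right end.\<close>
  have piece: "f x = (if even (j + m) then lam * x - j else real (j + 1) - lam * x)"
    if fl: "f (real j / lam) = (if even (j + m) then 0 else 1)"
      and x: "real j / lam \<le> x" "x \<le> real (j + 1) / lam" "x \<le> 1" for j x
  proof (cases "x = real j / lam")
    case True
    then show ?thesis using fl lam by auto
  next
    case False
    let ?p = "real j / lam"
    have px: "?p < x" "0 \<le> ?p" using False x lam by auto
    have "{?p<..<x} \<inter> critical_points f = {}"
    proof -
      have "\<not> (real j / lam < real i / lam \<and> real i / lam < real (j + 1) / lam)" for i
        using lam by (auto simp: divide_less_cancel)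
      then show ?thesis using crit x by fastforce
    qed
    then obtain s c where s: "s \<in> {lam, -lam}" "\<forall>y\<in>{?p..x}. f y = s * y + c"
      using affine_if_no_critical_point[OF \<open>finite B\<close> aff] px x by blast
    have fx: "f x = f ?p + s * (x - ?p)" using s(2) px by (simp add: algebra_simps)
    have "x \<in> {0..1}" using px x by simp
    then have "f x \<in> {0..1}" using range by blast
    moreover have lamx: "lam * (x - ?p) = lam * x - j"
      using lam by (simp add: right_diff_distrib)
    have "lam * (x - ?p) > 0"
      using px lam by (intro mult_pos_pos) auto
    then have "s = lam \<Longrightarrow> f x > f ?p" "s = - lam \<Longrightarrow> f x < f ?p"
      using fx by simp_all
    ultimately have "s = (if even (j + m) then lam else -lam)"
      using fl s(1) by (auto split: if_splits)
    then show ?thesis using fx fl lamx by simp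
  qed
  have left: "j \<le> m \<Longrightarrow> f (real j / lam) = (if even (j + m) then 0 else 1)" for j
  proof (induction j)
    case 0
    then show ?case using f0 by simp
  next
    case (Suc j)
    have "real (Suc j) / lam \<le> 1"
      using Suc.prems lam m by (simp add: le_nat_iff le_floor_iff)
    moreover have "real j / lam \<le> real (Suc j) / lam" using lam by (simp add: divide_right_mono)
    ultimately show ?case
      using piece[OF Suc.IH, of "real (Suc j) / lam"] Suc.prems lam by auto
  qed
  show ?thesis using piece[OF left] assms by blast
qed


section \<open>Permutation types\<close>

text \<open>Below \<open>i\<close> the two listings agree, so \<open>u i = v j\<close> with
  \<open>j < i\<close> would contradict the injectivity of \<open>u\<close>. Hence
  \<open>v i \<le> u i\<close>, and exchanging the roles gives equality.\<close>

lemma strict_mono_on_image_unique: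
  fixes x y :: "nat \<Rightarrow> real"
  assumes x: "strict_mono_on S x" and y: "strict_mono_on S y" and im: "x ` S = y ` S"
    and "i \<in> S"
  shows "x i = y i"
  using \<open>i \<in> S\<close>
proof (induction i rule: less_induct)
  case (less i)
  have le: "v i \<le> u i"
    if u: "strict_mono_on S u" and v: "strict_mono_on S v" and im: "u ` S = v ` S"
      and IH: "\<And>j. j < i \<Longrightarrow> j \<in> S \<Longrightarrow> u j = v j" for u v :: "nat \<Rightarrow> real"
  proof -
    obtain j where j: "j \<in> S" "u i = v j" using im less.prems by (metis imageE imageI)
    have "\<not> j < i"
      using IH j u less.prems by (metis order_less_irrefl strict_mono_onD)
    then show ?thesis
      using j v less.prems by (metis linorder_neqE_nat order.refl order_less_imp_le strict_mono_onD)
  qed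
  show ?case
    using le[OF x y im] le[OF y x im[symmetric]] less.IH by (metis order_antisym)
qed

text \<open>The increasing listing of the orbit is unique and determines the permutation on
  \<open>S\<close>; off \<open>S\<close> both permutations are the identity.\<close>

lemma permutation_type_unique:
  assumes "permutation_type S f r" "permutation_type S f r'"
  shows "r = r'"
proof
  fix i
  from assms obtain x y where r: "r permutes S" "r' permutes S"
    and x: "strict_mono_on S x" "x ` S = range (\<lambda>i. (f ^^ i) 1)" "\<forall>i\<in>S. f (x i) = x (r i)"
    and y: "strict_mono_on S y" "y ` S = range (\<lambda>i. (f ^^ i) 1)" "\<forall>i\<in>S. f (y i) = y (r' i)"
    unfolding permutation_type_def by blast
  have xy: "x i = y i" if "i \<in> S" for i
    using strict_mono_on_image_unique[OF x(1) y(1)] x(2) y(2) that by simp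
  show "r i = r' i"
  proof (cases "i \<in> S")
    case True
    then have S: "r i \<in> S" "r' i \<in> S" using r by (auto simp: permutes_in_image)
    then have "x (r i) = x (r' i)" using x(3) y(3) xy True by metis
    then show ?thesis using strict_mono_on_imp_inj_on[OF x(1)] S by (auto dest: inj_onD)
  next
    case False
    then show ?thesis using r by (simp add: permutes_not_in)
  qed
qed

lemma card_permutation_type:
  assumes "permutation_type S f r"
  shows "card S = card (range (\<lambda>i. (f ^^ i) 1))"
  using assms unfolding permutation_type_def
  by (metis card_image strict_mono_on_imp_inj_on)

lemma permutes_if_inj_on:
  assumes "finite S" "inj_on r S" "r ` S \<subseteq> S" "\<And>i. i \<notin> S \<Longrightarrow> r i = i"
  shows "r permutes S"
  using assms by (intro bij_imp_permutes) (auto simp: bij_betw_def endo_inj_surj)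

section \<open>The standard permutations and their parameters\<close>

lemma rho_e_permutes: "2 \<le> k \<Longrightarrow> k \<le> n \<Longrightarrow> rho_e n k permutes {1..n}"
  by (rule permutes_if_inj_on) (auto simp: rho_e_def inj_on_def split: if_splits)

lemma rho_o_permutes: "2 \<le> k \<Longrightarrow> k \<le> n \<Longrightarrow> rho_o n k permutes {0..n}"
  by (rule permutes_if_inj_on) (auto simp: rho_o_def inj_on_def split: if_splits)

lemma kappa_permutes: "2 \<le> k \<Longrightarrow> k \<le> n \<Longrightarrow> kappa k permutes {1..n}"
  by (rule permutes_if_inj_on) (auto simp: kappa_def inj_on_def split: if_splits)

lemma rho_permutes:
  assumes "2 \<le> k" "k \<le> n"
  shows "rho m n k permutes labels m n"
proof -
  have "rho_2 n k permutes {1..n}"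
    unfolding rho_2_def using rho_e_permutes kappa_permutes assms
    by (intro permutes_compose permutes_inv) auto
  then show ?thesis
    using assms rho_e_permutes rho_o_permutes by (auto simp: rho_def labels_def)
qed

text \<open>The parameter is a preimage: \<open>k\<close> is sent to \<open>1\<close> if
  \<open>m\<close> is not \<open>2\<close>, and \<open>k - 1\<close> is sent to \<open>n\<close> if
  \<open>m = 2\<close>.\<close>

lemma rho_inject:
  assumes k: "2 \<le> k" "k \<le> n" and k': "2 \<le> k'" "k' \<le> n" and eq: "rho m n k = rho m n k'"
  shows "k = k'"
proof (cases "m = 2")
  case True
  have "rho_2 n j (j - 1) = n" if "2 \<le> j" "j \<le> n" for j
  proof -
    have "kappa j (j - 1) = 1" "kappa j n = n" using that by (auto simp: kappa_def)
    then show ?thesis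
      using permutes_inj[OF kappa_permutes[OF that]] that
      by (simp add: rho_2_def rho_e_def inv_f_eq)
  qed
  then have "rho m n k (k - 1) = rho m n k (k' - 1)"
    using True k k' eq by (metis rho_def)
  then have "k - 1 = k' - 1"
    using permutes_inj[OF rho_permutes[OF k]] by (metis injD)
  then show ?thesis using k k' by simp
next
  case False
  have "rho m n j j = 1" if "2 \<le> j" "j \<le> n" for j
    using that False by (auto simp: rho_def rho_e_def rho_o_def)
  then have "rho m n k k = rho m n k k'"
    using k k' eq by metis
  then show ?thesis
    using permutes_inj[OF rho_permutes[OF k]] by (metis injD)
qed

text \<open>The size of the orbit determines \<open>n\<close>, and then the permutation determines
  \<open>k\<close>, so the definite description in \<open>Phi\<close> has only one
  candidate.\<close>

lemma Phi_eqI: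
  assumes "3 \<le> n" "2 \<le> k" "k \<le> n - 1" "coprime (n - k) (n - 1)"
    and type: "permutation_type (labels m n) f (rho m n k)"
  shows "Phi m f = real (n - k) / real (n - 1)"
  unfolding Phi_def
proof (rule the_equality)
  fix q
  assume "\<exists>n k. 3 \<le> n \<and> 2 \<le> k \<and> k \<le> n - 1 \<and> coprime (n - k) (n - 1) \<and>
    permutation_type (labels m n) f (rho m n k) \<and> q = real (n - k) / real (n - 1)"
  then obtain n' k' where *: "3 \<le> n'" "2 \<le> k'" "k' \<le> n' - 1"
      "permutation_type (labels m n') f (rho m n' k')" "q = real (n' - k') / real (n' - 1)"
    by blast
  have "card (labels m n) = card (labels m n')"
    using card_permutation_type[OF type] card_permutation_type[OF *(4)] by simp
  then have "n' = n" by (auto simp: labels_def split: if_splits)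
  moreover have "k = k'"
  proof (rule rho_inject)
    show "rho m n k = rho m n k'"
      using permutation_type_unique[OF type] *(4) \<open>n' = n\<close> by blast
  qed (use assms(1-3) *(1-3) \<open>n' = n\<close> in linarith)+
  ultimately show "q = real (n - k) / real (n - 1)" using *(5) by simp
qed (use assms in blast)


section \<open>The orbit of the right end point\<close>

text \<open>An integer value \<open>k\<close> is attained at \<open>t = k * b / a\<close>. The least
  \<open>k\<close> with \<open>a * i \<le> k * b\<close> is \<open>a * i / b\<close> rounded up, so
  it suffices to test this one.\<close>

lemma ex_multiple_in_interval_iff:
  fixes a b i :: nat
  assumes "0 < a" "0 < b"
  shows "(\<exists>t. real i \<le> t \<and> t \<le> real (i + 1) \<and> real a / real b * t \<in> \<nat>) \<longleftrightarrow>
    (a * i + b - 1) div b * b \<le> a * (i + 1)"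
proof -
  let ?c = "(a * i + b - 1) div b"
  have c: "a * i \<le> ?c * b"
    using div_mult_mod_eq[of "a * i + b - 1" b] mod_less_divisor[of b "a * i + b - 1"] assms
    by linarith
  have "(\<exists>t. real i \<le> t \<and> t \<le> real (i + 1) \<and> real a / real b * t \<in> \<nat>) \<longleftrightarrow>
    (\<exists>k. a * i \<le> k * b \<and> k * b \<le> a * (i + 1))" (is "?L \<longleftrightarrow> ?R")
  proof
    assume ?L
    then obtain t k where t: "real i \<le> t" "t \<le> real (i + 1)" "real a / real b * t = real k"
      by (auto elim: Nats_cases)
    then have "real k * real b = real a * t" using assms by (simp add: field_simps)
    moreover have "real a * real i \<le> real a * t" "real a * t \<le> real a * real (i + 1)"
      using t by (intro mult_left_mono; simp)+
    ultimately have "real (a * i) \<le> real (k * b)" "real (k * b) \<le> real (a * (i + 1))"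
      by (simp_all only: of_nat_mult)
    then show ?R unfolding of_nat_le_iff by blast
  next
    assume ?R
    then obtain k where "a * i \<le> k * b" "k * b \<le> a * (i + 1)" by blast
    then have "real a * real i \<le> real k * real b" "real k * real b \<le> real a * real (i + 1)"
      by (metis of_nat_le_iff of_nat_mult)+
    then have "real i \<le> real k * real b / real a" "real k * real b / real a \<le> real (i + 1)"
      using assms by (simp_all add: field_simps)
    moreover have "real a / real b * (real k * real b / real a) = real k" using assms by simp
    ultimately show ?L by (metis of_nat_in_Nats)
  qed
  also have "\<dots> \<longleftrightarrow> ?c * b \<le> a * (i + 1)"
  proof
    assume ?R
    then obtain k where k: "a * i \<le> k * b" "k * b \<le> a * (i + 1)" by blast
    have "a * i + b - 1 < (k + 1) * b" using k assms by simp
    then have "?c < k + 1" using assms by (simp add: less_mult_imp_div_less)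
    then have "?c * b \<le> k * b" by simp
    with k show "?c * b \<le> a * (i + 1)" by linarith
  qed (use c in blast)
  finally show ?thesis .
qed

text \<open>The slope, hidden by a quantifier in \<open>explicit_map\<close>, becomes a parameter,
  so that two slopes can be compared later.\<close>

locale explicit_zigzag =
  fixes m a b :: nat and f :: "real \<Rightarrow> real" and lam :: real
  assumes m: "2 \<le> m" and a: "0 < a" "a < b" and coprime: "coprime a b"
    and zz: "zigzag lam f" and card: "card (critical_points f) = m"
    and f0: "f 0 = (if even m then 0 else 1)"
    and addresses: "\<And>i. i + 2 \<le> b \<Longrightarrow> (f ^^ i) 1 \<in> branch lam m
       (if \<exists>t. real i \<le> t \<and> t \<le> real (i + 1) \<and> real a / real b * t \<in> \<nat> then m else m - 2)"
    and address_last: "(f ^^ (b - 1)) 1 \<in> branch lam m (m - 1)"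
    and orbit_b: "(f ^^ b) 1 = 1 / lam"

lemma explicit_mapE:
  assumes "explicit_map m a b f" "2 \<le> m" "0 < a" "a < b" "coprime a b"
  obtains lam where "explicit_zigzag m a b f lam"
  using assms unfolding explicit_map_def explicit_zigzag_def Let_def by blast

context explicit_zigzag
begin

abbreviation x :: "nat \<Rightarrow> real" where "x i \<equiv> (f ^^ i) 1"

section \<open>Rounded multiples of \<open>a / b\<close> and ranks\<close>

text \<open>\<open>a i / b\<close> rounded up, and the position of \<open>x i\<close> in the order of \<open>x 0, \<dots>, x (b - 1)\<close>.\<close>

definition c :: "nat \<Rightarrow> nat" where "c i = (a * i + b - 1) div b"
definition r :: "nat \<Rightarrow> nat" where "r i = (a * i + b - 1) mod b"

text \<open>Division with remainder of \<open>a * i - 1\<close> by \<open>b\<close>, shifted by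
  \<open>b\<close> and written without truncated subtraction.\<close>

lemma c_r: "c i * b + r i + 1 = a * i + b" "r i < b"
  using a div_mult_mod_eq[of "a * i + b - 1" b] by (auto simp: c_def r_def)

lemma c_r_unique:
  assumes "c' * b + r' + 1 = a * i + b" "r' < b"
  shows "c i = c' \<and> r i = r'"
proof -
  have "a * i + b - 1 = r' + c' * b" using assms by linarith
  then show ?thesis using assms(2) by (simp add: c_def r_def)
qed

lemma c_r_Suc:
  "c (Suc i) = (if r i + a < b then c i else Suc (c i))"
  "r (Suc i) = (if r i + a < b then r i + a else r i + a - b)"
proof -
  let ?c = "if r i + a < b then c i else Suc (c i)"
  let ?r = "if r i + a < b then r i + a else r i + a - b"
  have "?c * b + ?r + 1 = a * Suc i + b" "?r < b"
    using c_r[of i] a by auto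
  then show "c (Suc i) = ?c" "r (Suc i) = ?r" using c_r_unique by blast+
qed

text \<open>The equation means that \<open>b\<close> divides \<open>a * (i + 1)\<close>, hence
  \<open>i + 1\<close> by coprimality. It singles out the one time at which the orbit meets a
  decreasing branch.\<close>

lemma r_eq_iff:
  assumes "i < b"
  shows "r i + a + 1 = b \<longleftrightarrow> i = b - 1"
proof
  assume "r i + a + 1 = b"
  then have "c i * b = a * (i + 1)" using c_r[of i] by (simp add: algebra_simps)
  then have "b dvd a * (i + 1)" by (metis dvd_triv_right)
  then have "b dvd i + 1"
    using coprime by (metis coprime_commute coprime_dvd_mult_right_iff)
  then show "i = b - 1" using assms by (auto dest: dvd_imp_le)
next
  assume i: "i = b - 1"
  obtain b' where "b = Suc b'" using a by (cases b) auto
  then show "r i + a + 1 = b"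
    using c_r_unique[of a "b - 1 - a" i] a i by (auto simp: algebra_simps)
qed

lemma c_last: "c (b - 1) = a"
proof -
  obtain b' where "b = Suc b'" using a by (cases b) auto
  then show ?thesis
    using c_r_unique[of a "b - 1 - a" "b - 1"] a by (auto simp: algebra_simps)
qed

lemma inj_r: "inj_on r {..<b}"
proof -
  have "j \<le> i" if "i < b" "j < b" "r i = r j" for i j
  proof (rule ccontr)
    assume "\<not> j \<le> i"
    have "a * j - a * i = c j * b - c i * b"
      using c_r[of i] c_r[of j] that by linarith
    then have "a * (j - i) = (c j - c i) * b"
      by (simp only: diff_mult_distrib diff_mult_distrib2)
    then have "b dvd a * (j - i)" by (metis dvd_triv_right)
    then have "b dvd j - i"
      using coprime by (metis coprime_commute coprime_dvd_mult_right_iff)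
    then show False using that \<open>\<not> j \<le> i\<close> by (auto dest: dvd_imp_le)
  qed
  then show ?thesis by (metis inj_onI lessThan_iff order_antisym)
qed

lemma bij_r: "bij_betw r {..<b} {..<b}"
proof -
  have "r ` {..<b} \<subseteq> {..<b}" by (rule image_subsetI) (simp add: c_r(2))
  from endo_inj_surj[OF finite_lessThan this inj_r] inj_r show ?thesis
    by (rule bij_betw_imageI[rotated])
qed

section \<open>Addresses in terms of ranks\<close>

lemma c_le_iff: "c i * b \<le> a * (i + 1) \<longleftrightarrow> b \<le> r i + a + 1"
proof -
  have "a * (i + 1) = a * i + a" by simp
  then show ?thesis using c_r(1)[of i] by linarith
qed

text \<open>Written through the rank \<open>r i\<close> to make it visibly nondecreasing in the
  rank, which is what ordering the orbit requires.\<close>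

definition address :: "nat \<Rightarrow> nat" where
  "address i = (if b \<le> r i + a then m else if r i + a + 1 = b then m - 1 else m - 2)"

lemma x_in_branch:
  assumes "i < b"
  shows "x i \<in> branch lam m (address i)"
proof (cases "i = b - 1")
  case True
  then show ?thesis
    using address_last r_eq_iff[OF assms] by (simp add: address_def)
next
  case False
  define hit where
    "hit \<longleftrightarrow> (\<exists>t. real i \<le> t \<and> t \<le> real (i + 1) \<and> real a / real b * t \<in> \<nat>)"
  have "hit \<longleftrightarrow> b \<le> r i + a + 1"
    using ex_multiple_in_interval_iff[of a b i, folded c_def hit_def] a c_le_iff by simp
  \<comment> \<open>Equality belongs to time \<open>b - 1\<close> alone, so here a hit is the same
    as \<open>b \<le> r i + a\<close>.\<close>
  moreover have "r i + a + 1 \<noteq> b" using False r_eq_iff[OF assms] by blast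
  moreover have "i + 2 \<le> b" using False assms by simp
  ultimately show ?thesis
    using addresses[of i, folded hit_def] by (cases "b \<le> r i + a") (simp_all add: address_def)
qed

section \<open>Affine dynamics and order of the orbit\<close>

lemma lam_pos: "lam > 1"
  using zz by (simp add: zigzag_def)

lemma f_eq:
  assumes "j \<le> m" "real j / lam \<le> y" "y \<le> real (j + 1) / lam" "y \<le> 1"
  shows "f y = (if even (j + m) then lam * y - j else real (j + 1) - lam * y)"
  using zigzag_eq[OF zz card f0] assms by blast

text \<open>At time \<open>0\<close> the rank is \<open>b - 1\<close>, the highest one, so the point
  \<open>1\<close> has address \<open>m\<close> and lies strictly to the right of
  \<open>m / lam\<close>.\<close>

lemma m_less_lam: "real m < lam"
proof -
  have "b \<le> r 0 + a" using c_r_unique[of 0 "b - 1" 0] a by auto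
  then have "1 \<in> branch lam m m" using x_in_branch[of 0] a by (simp add: address_def)
  then show ?thesis using m lam_pos by (auto simp: branch_def field_simps)
qed

lemma lam_le: "lam \<le> real (m + 1)"
proof -
  have "m = nat \<lfloor>lam\<rfloor>"
  proof -
    have "critical_points f = (\<lambda>i. real i / lam) ` {1..nat \<lfloor>lam\<rfloor>}"
      using zz by (simp add: zigzag_def)
    moreover have "inj_on (\<lambda>i. real i / lam) {1..nat \<lfloor>lam\<rfloor>}"
      using lam_pos by (auto simp: inj_on_def)
    ultimately show ?thesis using card by (simp add: card_image)
  qed
  then show ?thesis using lam_pos by linarith
qed

text \<open>Treats the end branches like the inner ones: \<open>m < lam\<close> keeps the right ends
  of the lower branches within \<open>{0..1}\<close>, while \<open>lam \<le> m + 1\<close> puts the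
  nominal right end of branch \<open>m\<close> at or beyond \<open>1\<close>.\<close>

lemma branch_bounds:
  assumes "j \<le> m" "y \<in> branch lam m j"
  shows "real j / lam \<le> y" "y \<le> real (j + 1) / lam" "y \<le> 1"
    "0 < j \<Longrightarrow> real j / lam < y" "j < m \<Longrightarrow> y < real (j + 1) / lam"
proof -
  have top: "real (m + 1) / lam \<ge> 1" using lam_le lam_pos by simp
  have less: "real (j + 1) / lam \<le> 1" if "j < m"
    using that m_less_lam lam_pos by simp
  consider "j = m" "real m / lam < y" "y \<le> 1"
    | "j < m" "j = 0" "0 \<le> y" "y < 1 / lam"
    | "j < m" "0 < j" "real j / lam < y" "y < real (j + 1) / lam"
    using assms m by (force simp: branch_def split: if_splits)
  then have "real j / lam \<le> y \<and> y \<le> real (j + 1) / lam \<and> y \<le> 1 \<and>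
    (0 < j \<longrightarrow> real j / lam < y) \<and> (j < m \<longrightarrow> y < real (j + 1) / lam)"
    using top less by cases auto
  then show "real j / lam \<le> y" "y \<le> real (j + 1) / lam" "y \<le> 1"
    "0 < j \<Longrightarrow> real j / lam < y" "j < m \<Longrightarrow> y < real (j + 1) / lam"
    by blast+
qed

lemma address_le: "address i \<le> m"
  by (simp add: address_def)

text \<open>Branches \<open>m\<close> and \<open>m - 2\<close> are increasing by parity; branch
  \<open>m - 1\<close> is decreasing and is visited only at time \<open>b - 1\<close>.\<close>

lemma x_Suc:
  assumes "i < b"
  shows "x (Suc i) = (if i = b - 1 then m - lam * x i else lam * x i - address i)"
proof -
  have "even (address i + m) \<longleftrightarrow> i \<noteq> b - 1"
    using r_eq_iff[OF assms] m by (auto simp: address_def)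
  moreover have "i = b - 1 \<Longrightarrow> address i + 1 = m"
    using r_eq_iff[OF assms] m by (auto simp: address_def)
  moreover have "x (Suc i) = (if even (address i + m) then lam * x i - address i
      else real (address i + 1) - lam * x i)"
    using f_eq[OF address_le branch_bounds(1-3)[OF address_le x_in_branch[OF assms]]]
    by (simp only: funpow.simps comp_apply)
  ultimately show ?thesis by presburger
qed

text \<open>Different addresses are ordered like the ranks, and a branch end separates the points.
  Equal addresses mean a common increasing branch and a common shift of the ranks, so the order can
  be pulled back from the next time; the induction is on the time left before
  \<open>b\<close>.\<close>

lemma x_less:
  assumes "i < b" "j < b" "r i < r j"
  shows "x i < x j"
  using assms
proof (induction "b - max i j" arbitrary: i j rule: less_induct)
  case less
  show ?case
  proof (cases "address i = address j")
    case True
    \<comment> \<open>A common address \<open>m - 1\<close> would force equal ranks.\<close>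
    then have "(r i + a < b \<longleftrightarrow> r j + a < b) \<and> r i + a + 1 \<noteq> b \<and> r j + a + 1 \<noteq> b"
      using less.prems m by (simp add: address_def split: if_splits)
    then have ij: "i \<noteq> b - 1" "j \<noteq> b - 1" and "r (Suc i) < r (Suc j)"
      using r_eq_iff[OF \<open>i < b\<close>] r_eq_iff[OF \<open>j < b\<close>] less.prems
      by (auto simp: c_r_Suc)
    then have "x (Suc i) < x (Suc j)"
      using less.hyps[of "Suc i" "Suc j"] less.prems ij by fastforce
    then show ?thesis
      using x_Suc[of i] x_Suc[of j] ij True less.prems lam_pos by simp
  next
    case False
    then have "address i < address j"
      using less.prems m by (auto simp: address_def split: if_splits)
    then have "address i < m" "real (address i + 1) / lam \<le> real (address j) / lam"
      using address_le[of j] lam_pos by (auto intro!: divide_right_mono)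
    then show ?thesis
      using branch_bounds(5)[OF address_le x_in_branch[OF \<open>i < b\<close>]]
        branch_bounds(1)[OF address_le x_in_branch[OF \<open>j < b\<close>]] by linarith
  qed
qed


section \<open>Labels of the orbit and its permutation type\<close>

text \<open>The points of the orbit, labelled as in \<^const>\<open>rho_o\<close>; for \<open>m = 2\<close> this labelling is
  increasing only after composition with \<^const>\<open>kappa\<close>.\<close>

definition y :: "nat \<Rightarrow> real" where
  "y l = (if l = 0 then 0 else if l = 1 then 1 / lam else x (inv_into {..<b} r (l - 2)))"

lemma y_r: "i < b \<Longrightarrow> y (r i + 2) = x i"
  using inj_r by (simp add: y_def inv_into_f_f)

lemma label_cases:
  assumes "2 \<le> l" "l \<le> b + 1"
  obtains i where "i < b" "l = r i + 2" "y l = x i"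
proof -
  have "l - 2 \<in> r ` {..<b}" using bij_r assms a by (auto simp: bij_betw_def)
  then obtain i where "i < b" "l = r i + 2" using assms by force
  then show ?thesis using that[of i] y_r[of i] by simp
qed

lemma y_less:
  assumes "2 \<le> l" "l < l'" "l' \<le> b + 1"
  shows "y l < y l'"
proof -
  obtain i where "i < b" "l = r i + 2" "y l = x i" using label_cases[of l] assms by auto
  moreover obtain j where "j < b" "l' = r j + 2" "y l' = x j"
    using label_cases[of l'] assms by auto
  ultimately show ?thesis using x_less assms by simp
qed

lemma f_inverse_lam: "f (1 / lam) = (if even m then 1 else 0)"
  using f_eq[of 0 "1 / lam"] lam_pos by auto

text \<open>Here \<open>n = b + 1\<close> and \<open>k = b + 1 - a\<close>, so that
  \<open>(n - k) / (n - 1) = a / b\<close>. A step adds \<open>a\<close> to the rank modulo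
  \<open>b\<close>, which is the translation part of the permutation; the offset \<open>2\<close>
  leaves room for the labels of \<open>0\<close> and \<open>1 / lam\<close>, and time
  \<open>b - 1\<close> leads to label \<open>1\<close>.\<close>

lemma f_y:
  assumes "l \<in> labels m (b + 1)"
  shows "f (y l) = y ((if even m then rho_e else rho_o) (b + 1) (b + 1 - a) l)"
proof -
  have top: "y (b + 1) = 1"
    using y_r[of 0] c_r_unique[of 0 "b - 1" 0] a by auto
  have "l = 0 \<and> odd m \<or> l = 1 \<or> 2 \<le> l \<and> l \<le> b + 1"
    using assms by (auto simp: labels_def split: if_splits)
  then consider "l = 0" "odd m" | "l = 1" | "2 \<le> l" "l \<le> b + 1" by blast
  then show ?thesis
  proof cases
    case 1
    then show ?thesis using top f0 by (simp add: rho_o_def y_def)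
  next
    case 2
    then show ?thesis using top f_inverse_lam
      by (auto simp: rho_o_def rho_e_def) (auto simp: y_def)
  next
    case 3
    then obtain i where i: "i < b" "l = r i + 2" "y l = x i" by (rule label_cases)
    have rho: "(if even m then rho_e else rho_o) (b + 1) (b + 1 - a) l =
      (if r i + a + 1 < b then r i + a + 2 else r i + a + 2 - b)"
      using a i c_r(2)[of i] by (auto simp: rho_e_def rho_o_def)
    show ?thesis
    proof (cases "i = b - 1")
      case True
      then have "r i + a + 1 = b" using r_eq_iff i by blast
      moreover have "f (x i) = 1 / lam"
        using orbit_b True a by (cases b) auto
      ultimately show ?thesis using rho i(3) by (simp add: y_def)
    next
      case False
      then have "r i + a + 1 \<noteq> b" using r_eq_iff i by blast
      then have "(if even m then rho_e else rho_o) (b + 1) (b + 1 - a) l = r (Suc i) + 2"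
        unfolding rho c_r_Suc by auto
      then show ?thesis using y_r[of "Suc i"] i False by simp
    qed
  qed
qed

lemma y_1: "y 1 = 1 / lam"
  by (simp add: y_def)

lemma y_in_orbit:
  assumes "l \<in> labels m (b + 1)"
  shows "y l \<in> range x"
proof -
  consider "l = 0" "odd m" | "l = 1" | "2 \<le> l" "l \<le> b + 1"
    using assms by (fastforce simp: labels_def split: if_splits)
  then show ?thesis
  proof cases
    case 1
    \<comment> \<open>For odd \<open>m\<close> the orbit reaches \<open>0\<close> right after
      \<open>1 / lam\<close>, its point at time \<open>b\<close>.\<close>
    then have "x (Suc b) = 0" using orbit_b f_inverse_lam by simp
    then show ?thesis using 1 by (metis y_def rangeI)
  next
    case 2
    then show ?thesis using orbit_b y_1 by (metis rangeI)
  next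
    case 3
    then show ?thesis by (auto elim: label_cases)
  qed
qed

lemma y_image_labels: "y ` labels m (b + 1) = range x"
proof
  show "y ` labels m (b + 1) \<subseteq> range x" using y_in_orbit by blast
  have "x i \<in> y ` labels m (b + 1)" for i
  proof (induction i)
    case 0
    have "r 0 + 2 \<in> labels m (b + 1)" using c_r(2)[of 0] by (simp add: labels_def)
    then show ?case using y_r[of 0] a by (metis gr_zeroI image_eqI less_nat_zero_code)
  next
    case (Suc i)
    then obtain l where l: "l \<in> labels m (b + 1)" "x i = y l" by blast
    let ?rho = "(if even m then rho_e else rho_o) (b + 1) (b + 1 - a)"
    have "?rho permutes labels m (b + 1)"
      using rho_e_permutes[of "b + 1 - a" "b + 1"] rho_o_permutes[of "b + 1 - a" "b + 1"] a
      by (simp add: labels_def)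
    then have "?rho l \<in> labels m (b + 1)" using l by (simp add: permutes_in_image)
    then show ?case using f_y[OF l(1)] l(2) by auto
  qed
  then show "range x \<subseteq> y ` labels m (b + 1)" by blast
qed

text \<open>Only address \<open>0\<close> lies to the left of \<open>1 / lam\<close>, and among
  these times it occurs just as \<open>m - 2\<close> with \<open>m = 2\<close>. This is why
  \<open>m = 2\<close> has its own permutation type.\<close>

lemma x_inverse_lam:
  assumes "i < b"
  shows "x i < 1 / lam \<longleftrightarrow> m = 2 \<and> r i + a + 1 < b" "x i \<noteq> 1 / lam"
proof -
  note B = branch_bounds[OF address_le x_in_branch[OF assms]]
  have "x i < 1 / lam" if "m = 2 \<and> r i + a + 1 < b"
  proof -
    have "address i = 0" using that unfolding address_def by simp
    then show ?thesis using B(5) m by simp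
  qed
  moreover have "1 / lam < x i" if "\<not> (m = 2 \<and> r i + a + 1 < b)"
  proof -
    have "1 \<le> address i" using that m by (auto simp: address_def)
    moreover have "1 / lam \<le> real (address i) / lam"
      using \<open>1 \<le> address i\<close> lam_pos by (intro divide_right_mono) auto
    ultimately show ?thesis using B(4) by simp
  qed
  ultimately show "x i < 1 / lam \<longleftrightarrow> m = 2 \<and> r i + a + 1 < b" "x i \<noteq> 1 / lam"
    by fastforce+
qed

lemma y_less_inverse_lam:
  assumes "2 \<le> l" "l \<le> b + 1"
  shows "m = 2 \<and> l < b + 1 - a \<Longrightarrow> y l < y 1" "\<not> (m = 2 \<and> l < b + 1 - a) \<Longrightarrow> y 1 < y l"
proof -
  obtain i where i: "i < b" "l = r i + 2" "y l = x i" using assms by (rule label_cases)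
  show "m = 2 \<and> l < b + 1 - a \<Longrightarrow> y l < y 1" "\<not> (m = 2 \<and> l < b + 1 - a) \<Longrightarrow> y 1 < y l"
    using x_inverse_lam[OF i(1)] i(2,3) y_1 by auto
qed

text \<open>If \<open>m\<close> is not \<open>2\<close>, then \<open>y\<close> itself is increasing.
  If \<open>m = 2\<close>, the points with labels \<open>2, ..., k - 1\<close> lie below the one
  with label \<open>1\<close>; \<open>kappa\<close> reorders them, and conjugation by it turns
  \<open>rho_e\<close> into \<open>rho_2\<close>.\<close>

lemma permutation_type_rho:
  "permutation_type (labels m (b + 1)) f (rho m (b + 1) (b + 1 - a))"
proof (cases "m = 2")
  case False
  have "strict_mono_on (labels m (b + 1)) y"
  proof (rule strict_mono_onI)
    fix l l' assume l: "l \<in> labels m (b + 1)" "l' \<in> labels m (b + 1)" "l < l'"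
    have le: "l' \<le> b + 1" using l(2) by (simp add: labels_def split: if_splits)
    have y0: "y 0 < y 1" using lam_pos by (simp add: y_def)
    have y1: "y 1 < y l'" if "2 \<le> l'" using y_less_inverse_lam(2)[OF that le] False by blast
    consider "l = 0" "l' = 1" | "l = 0" "2 \<le> l'" | "l = 1" "2 \<le> l'" | "2 \<le> l"
      using l(3) by linarith
    then show "y l < y l'"
      using y0 y1 y_less[OF _ l(3) le] by cases (blast intro: less_trans)+
  qed
  moreover have "rho m (b + 1) (b + 1 - a) = (if even m then rho_e else rho_o) (b + 1) (b + 1 - a)"
    using False by (auto simp: rho_def)
  ultimately show ?thesis
    unfolding permutation_type_def
    using rho_permutes[of "b + 1 - a" "b + 1" m] a y_image_labels f_y by auto
next
  case True
  let ?k = "b + 1 - a" and ?S = "{1..b + 1}"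
  have S: "labels m (b + 1) = ?S" using True by (simp add: labels_def)
  have \<kappa>: "kappa ?k permutes ?S" using kappa_permutes[of ?k "b + 1"] a by simp
  have "strict_mono_on ?S (y \<circ> kappa ?k)"
  proof (rule strict_mono_onI)
    fix l l' assume l: "l \<in> ?S" "l' \<in> ?S" "l < l'"
    \<comment> \<open>Positions below \<open>?k - 1\<close> carry the labels
      \<open>2, ..., ?k - 1\<close>, position \<open>?k - 1\<close> carries label \<open>1\<close>,
      and the later positions keep their labels.\<close>
    consider "l' < ?k - 1" | "l < ?k - 1" "l' = ?k - 1" | "l < ?k - 1" "?k \<le> l'"
      | "l = ?k - 1" "?k \<le> l'" | "?k \<le> l" using l(3) by linarith
    then show "(y \<circ> kappa ?k) l < (y \<circ> kappa ?k) l'"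
    proof cases
      case 1
      then show ?thesis using l y_less[of "l + 1" "l' + 1"] by (simp add: kappa_def)
    next
      case 2
      then show ?thesis using l True y_less_inverse_lam(1)[of "l + 1"] by (simp add: kappa_def)
    next
      case 3
      then have "kappa ?k l = l + 1" "kappa ?k l' = l'" "l + 1 < l'"
        using l a by (auto simp: kappa_def)
      then show ?thesis using l y_less[of "l + 1" l'] by simp
    next
      case 4
      then show ?thesis using l y_less_inverse_lam(2)[of l'] a by (simp add: kappa_def)
    next
      case 5
      then have "kappa ?k l = l" "kappa ?k l' = l'" "2 \<le> l"
        using l a by (auto simp: kappa_def)
      then show ?thesis using l y_less[of l l'] by simp
    qed
  qed
  moreover have "(y \<circ> kappa ?k) ` ?S = range x"
    using y_image_labels S permutes_image[OF \<kappa>] by (metis image_comp)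
  moreover have "f ((y \<circ> kappa ?k) l) = (y \<circ> kappa ?k) (rho m (b + 1) ?k l)" if "l \<in> ?S" for l
  proof -
    have "kappa ?k l \<in> labels m (b + 1)" using that \<kappa> S by (simp only: permutes_in_image)
    moreover have "kappa ?k (rho m (b + 1) ?k l) = rho_e (b + 1) ?k (kappa ?k l)"
      using permutes_inverses(1)[OF \<kappa>] True by (simp add: rho_def rho_2_def)
    ultimately show ?thesis using f_y True by simp
  qed
  moreover have "rho m (b + 1) ?k permutes ?S"
    using rho_permutes[of ?k "b + 1" m] a S by simp
  ultimately show ?thesis
    unfolding permutation_type_def S by blast
qed

lemma Phi_eq: "Phi m f = a / b"
proof -
  have "Phi m f = real (b + 1 - (b + 1 - a)) / real (b + 1 - 1)"
    by (rule Phi_eqI[OF _ _ _ _ permutation_type_rho]) (use a coprime in auto)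
  then show ?thesis using a by simp
qed

section \<open>Recovering \<open>a\<close> and \<open>b\<close> from the addresses\<close>

lemma address_eq:
  "address i = (if c i * b < a * (i + 1) then m else if c i * b = a * (i + 1) then m - 1 else m - 2)"
proof -
  have "a * (i + 1) = a * i + a" by simp
  then have "c i * b < a * (i + 1) \<longleftrightarrow> b \<le> r i + a" "c i * b = a * (i + 1) \<longleftrightarrow> r i + a + 1 = b"
    using c_r(1)[of i] by linarith+
  then show ?thesis by (simp add: address_def)
qed

text \<open>The address \<open>m - 1\<close> marks the time \<open>b - 1\<close>, so the addresses
  determine \<open>b\<close>.\<close>

lemma address_eq_pred_iff:
  assumes "i < b"
  shows "address i = m - 1 \<longleftrightarrow> i = b - 1"
proof -
  have "m - 1 \<noteq> m" "m - 2 \<noteq> m - 1" using m by simp_all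
  then have "address i = m - 1 \<longleftrightarrow> r i + a + 1 = b" unfolding address_def by simp
  then show ?thesis using r_eq_iff[OF assms] by simp
qed

text \<open>Makes \<open>c\<close> the number of earlier addresses \<open>m\<close>; hence it
  depends on the addresses only, and can be compared for two parameters.\<close>

lemma c_Suc: "i < b \<Longrightarrow> c (Suc i) = (if address i = m then Suc (c i) else c i)"
  using m by (auto simp: c_r_Suc address_def)

lemma c_0: "c 0 = 0"
  using c_r_unique[of 0 "b - 1" 0] a by auto

lemma x_last: "x (b - 1) = m / lam - (1 / lam)\<^sup>2"
proof -
  have "1 / lam = m - lam * x (b - 1)"
    using x_Suc[of "b - 1"] orbit_b a by simp
  then show ?thesis using lam_pos by (simp add: field_simps power2_eq_square)
qed

end

section \<open>Comparison of two maps\<close>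

locale explicit_zigzag_pair =
  F: explicit_zigzag m a b f lam + G: explicit_zigzag m a' b' g lam'
  for m a b f lam a' b' g lam' +
  assumes lam_ge: "lam' \<le> lam"
begin

text \<open>Both orbits start at \<open>1\<close>, and each step multiplies a nonnegative point by
  the slope and subtracts a common address. As \<open>Suc i\<close> is less than \<open>b\<close>
  and \<open>b'\<close>, the decreasing step is not reached.\<close>

lemma orbit_ge:
  assumes "i < b" "i < b'" "\<And>j. j < i \<Longrightarrow> F.address j = G.address j"
  shows "G.x i \<le> F.x i"
  using assms
proof (induction i)
  case 0
  then show ?case by simp
next
  case (Suc i)
  have "G.x i \<le> F.x i" using Suc by simp
  moreover have "0 \<le> G.x i"
    using G.branch_bounds(1)[OF G.address_le G.x_in_branch[of i]] Suc.prems G.lam_pos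
    by (smt (verit) Suc_lessD divide_nonneg_nonneg of_nat_0_le_iff)
  ultimately have "lam' * G.x i \<le> lam * F.x i"
    using lam_ge G.lam_pos by (intro mult_mono) auto
  moreover have "F.x (Suc i) = lam * F.x i - F.address i"
    using F.x_Suc[of i] Suc.prems(1) by (simp del: funpow.simps split: if_splits)
  moreover have "G.x (Suc i) = lam' * G.x i - G.address i"
    using G.x_Suc[of i] Suc.prems(2) by (simp del: funpow.simps split: if_splits)
  ultimately show ?case using Suc.prems(3)[of i] by linarith
qed

lemma c_eq:
  assumes "i < b" "i < b'" "\<And>j. j < i \<Longrightarrow> F.address j = G.address j"
  shows "F.c i = G.c i"
  using assms by (induction i) (simp_all add: F.c_0 G.c_0 F.c_Suc G.c_Suc)

lemma not_address_less:
  assumes "i < b" "i < b'" "\<And>j. j < i \<Longrightarrow> F.address j = G.address j"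
  shows "\<not> F.address i < G.address i"
proof
  assume less: "F.address i < G.address i"
  then have "F.address i < m" using G.address_le[of i] by simp
  then have "F.x i < real (F.address i + 1) / lam"
    using F.branch_bounds(5)[OF F.address_le F.x_in_branch[OF assms(1)]] by simp
  also have "\<dots> \<le> real (G.address i) / lam"
    using less F.lam_pos by (intro divide_right_mono) auto
  also have "\<dots> \<le> real (G.address i) / lam'"
    using lam_ge G.lam_pos by (intro divide_left_mono) auto
  also have "\<dots> \<le> G.x i"
    using G.branch_bounds(1)[OF G.address_le G.x_in_branch[OF assms(2)]] .
  finally show False using orbit_ge[OF assms] by simp
qed

text \<open>At the first difference the counts \<open>c\<close> still agree, so the larger fraction
  has the larger address, against \<open>not_address_less\<close>. Equal addresses then yield
  \<open>b\<close> from the mark \<open>m - 1\<close> and \<open>a\<close> as the count at time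
  \<open>b - 1\<close>.\<close>

lemma same_parameters:
  assumes "real a / real b \<le> real a' / real b'"
  shows "a = a' \<and> b = b'" "i < b \<Longrightarrow> F.address i = G.address i"
proof -
  have ab: "a * b' \<le> a' * b"
  proof -
    have "real a * real b' \<le> real a' * real b"
      using assms F.a G.a by (simp add: field_simps)
    then show ?thesis by (metis of_nat_le_iff of_nat_mult)
  qed
  have eq: "F.address i = G.address i" if "i < b" "i < b'" for i
    using that
  proof (induction i rule: less_induct)
    case (less i)
    then have IH: "\<And>j. j < i \<Longrightarrow> F.address j = G.address j" by simp
    have c: "F.c i = G.c i" using c_eq less.prems IH by blast
    \<comment> \<open>The address tests of both maps are brought to the common denominator
      \<open>b * b'\<close>.\<close>
    have "a * (i + 1) * b' \<le> a' * (i + 1) * b"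
      using mult_le_mono1[OF ab, of "i + 1"] by (simp only: ac_simps)
    moreover have "G.c i * b < a * (i + 1) \<longleftrightarrow> G.c i * b * b' < a * (i + 1) * b'"
        "G.c i * b' < a' * (i + 1) \<longleftrightarrow> G.c i * b * b' < a' * (i + 1) * b"
        "G.c i * b \<le> a * (i + 1) \<longleftrightarrow> G.c i * b * b' \<le> a * (i + 1) * b'"
        "G.c i * b' \<le> a' * (i + 1) \<longleftrightarrow> G.c i * b * b' \<le> a' * (i + 1) * b"
      using less.prems by (auto simp: mult.assoc mult.commute[of b b'] simp flip: mult.assoc)
    ultimately have "G.c i * b < a * (i + 1) \<Longrightarrow> G.c i * b' < a' * (i + 1)"
        "G.c i * b \<le> a * (i + 1) \<Longrightarrow> G.c i * b' \<le> a' * (i + 1)"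
      by linarith+
    then have "F.address i \<le> G.address i"
      unfolding F.address_eq G.address_eq c by auto
    then show ?case using not_address_less less.prems IH by fastforce
  qed
  have b: "b = b'"
  proof (rule ccontr)
    assume "b \<noteq> b'"
    then consider "b < b'" | "b' < b" by linarith
    then show False
    proof cases
      case 1
      then show ?thesis
        using eq[of "b - 1"] F.address_eq_pred_iff[of "b - 1"] G.address_eq_pred_iff[of "b - 1"] 1 F.a
        by fastforce
    next
      case 2
      then show ?thesis
        using eq[of "b' - 1"] F.address_eq_pred_iff[of "b' - 1"] G.address_eq_pred_iff[of "b' - 1"] 2 G.a
        by fastforce
    qed
  qed
  moreover have "a = a'"
    using c_eq[of "b - 1"] eq b F.c_last G.c_last F.a by simp
  ultimately show "a = a' \<and> b = b'" "i < b \<Longrightarrow> F.address i = G.address i"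
    using eq by auto
qed

text \<open>With equal parameters, a strictly larger slope would give a strictly smaller point at
  time \<open>b - 1\<close>, against \<open>orbit_ge\<close>.\<close>

lemma same_stretch:
  assumes "real a / real b \<le> real a' / real b'"
  shows "lam = lam'"
proof (rule ccontr)
  assume "lam \<noteq> lam'"
  then have less: "1 / lam < 1 / lam'" using lam_ge G.lam_pos by (simp add: frac_less2)
  have "1 / lam < 1" "1 / lam' < 1" using F.lam_pos G.lam_pos by simp_all
  \<comment> \<open>This product is the difference of the two values in \<open>x_last\<close>; the
    second factor is positive since \<open>m \<ge> 2\<close> and both reciprocals are below
    \<open>1\<close>.\<close>
  then have "(1 / lam' - 1 / lam) * (m - 1 / lam - 1 / lam') > 0"
    using less F.m by (intro mult_pos_pos) auto
  then have "F.x (b - 1) < G.x (b' - 1)"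
    unfolding F.x_last G.x_last by (simp add: algebra_simps power2_eq_square)
  moreover have "G.x (b - 1) \<le> F.x (b - 1)"
    using orbit_ge[of "b - 1"] same_parameters[OF assms] F.a by simp
  ultimately show False using same_parameters(1)[OF assms] by simp
qed

end

text \<open>Both directions are by contradiction, with the roles of the maps exchanged: the first
  uses equality of the parameters, the second equality of the slopes.\<close>

lemma explicit_zigzag_less_iff:
  assumes F: "explicit_zigzag m a b f lam" and G: "explicit_zigzag m a' b' g lam'"
  shows "real a / real b < real a' / real b' \<longleftrightarrow> lam < lam'"
proof
  assume less: "real a / real b < real a' / real b'"
  show "lam < lam'"
  proof (rule ccontr)
    assume "\<not> lam < lam'"
    then interpret explicit_zigzag_pair m a b f lam a' b' g lam'
      using F G by (simp add: explicit_zigzag_pair_def explicit_zigzag_pair_axioms_def)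
    show False using same_parameters(1) less by simp
  qed
next
  assume less: "lam < lam'"
  then interpret explicit_zigzag_pair m a' b' g lam' a b f lam
    using F G by (simp add: explicit_zigzag_pair_def explicit_zigzag_pair_axioms_def)
  show "real a / real b < real a' / real b'" using same_stretch less by force
qed

text \<open>The two hypotheses named \<open>earlier_\<close> are the known explicit description of
  \<open>PA m\<close> and the known equality of stretch factor and slope; they reduce the claim to
  slopes of explicit maps.\<close>

theorem theorem2:
  fixes m :: nat and f g :: "real \<Rightarrow> real"
    and Pf Pg :: "complex set" and psi_f psi_g :: "complex \<Rightarrow> complex"
  assumes "m \<ge> 2" and "f \<in> PA m" and "g \<in> PA m"
    and "thickening f Pf psi_f" and "thickening g Pg psi_g"
    and earlier_description:
      "\<forall>h\<in>PA m. \<exists>a b. 0 < a \<and> a < b \<and> coprime a b \<and> explicit_map m a b h"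
    and earlier_stretch_factor:
      "\<forall>h\<in>PA m. \<forall>P psi lam. thickening h P psi \<and> zigzag lam h \<longrightarrow> stretch_factor P psi = lam"
  shows "Phi m f < Phi m g \<longleftrightarrow> stretch_factor Pf psi_f < stretch_factor Pg psi_g"
proof -
  have "\<exists>a b lam. explicit_zigzag m a b h lam" if "h \<in> PA m" for h
    using earlier_description that \<open>m \<ge> 2\<close> by (meson explicit_mapE)
  then obtain a b lam a' b' lam' where F: "explicit_zigzag m a b f lam"
    and G: "explicit_zigzag m a' b' g lam'"
    using assms(2,3) by meson
  have "stretch_factor Pf psi_f = lam" "stretch_factor Pg psi_g = lam'"
    using earlier_stretch_factor assms(2-5) explicit_zigzag.zz[OF F] explicit_zigzag.zz[OF G]
    by blast+
  then show ?thesis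
    using explicit_zigzag.Phi_eq[OF F] explicit_zigzag.Phi_eq[OF G]
      explicit_zigzag_less_iff[OF F G] by simp
qed

end
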